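(* For each positive integer $k$, there exists a finite simple semi-transitively orientable graph $G$ with no odd cycle of length at most $2k+1$ such that $G$ has a pair of distinct non-adjacent vertices $u$ and $v$ for which $G+uv$ is not semi-transitively orientable.
   Context: Graphs are finite, undirected and simple. An orientation of a graph assigns to each edge one of its two directions; it is acyclic if it has no directed cycle. A digraph is transitive if whenever $v_1\to v_2$ and $v_2\to v_3$ are directed edges on three distinct vertices, $v_1\to v_3$ is also a directed edge. Given an acyclic orientation $\phi$ of a graph $G$, a shortcut in $\phi(G)$ is a non-transitive induced subdigraph of $\phi(G)$ on a vertex set $\{v_1,\dots,v_n\}$ with $n\ge 4$ (distinct vertices) that contains the directed path $v_1\to v_2\to\cdots\to v_n$ and the directed edge $v_1\to v_n$. An acyclic orientation $\phi$ is semi-transitive if $\phi(G)$ contains no shortcut, and a graph is semi-transitively orientable if it has a semi-transitive orientation. $G+uv$ denotes the graph obtained from $G$ by adding the edge $uv$. Cycles are subgraphs, not necessarily induced. *)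

theory Defs
  imports "Graph_Theory.Graph_Theory"
begin

text \<open>
  A finite simple undirected graph is a \<open>pair_graph\<close> of the Graph_Theory library: a finite,
  loop-free, symmetric digraph without parallel arcs, in which the edge \<open>uv\<close> is the pair of
  opposite arcs \<open>(u, v)\<close> and \<open>(v, u)\<close>. Digraphs are elements of the same record type without
  the symmetry requirement.
\<close>

definition orientation :: "'a pair_pre_digraph \<Rightarrow> 'a pair_pre_digraph \<Rightarrow> bool" where
  "orientation D G \<longleftrightarrow>
     pverts D = pverts G \<and> parcs D \<subseteq> parcs G \<and>
     (\<forall>u v. (u, v) \<in> parcs G \<longrightarrow> ((u, v) \<in> parcs D) \<noteq> ((v, u) \<in> parcs D))"

definition acyclic_orientation :: "'a pair_pre_digraph \<Rightarrow> 'a pair_pre_digraph \<Rightarrow> bool" where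
  "acyclic_orientation D G \<longleftrightarrow>
     orientation D G \<and> (\<nexists>c. pre_digraph.cycle (with_proj D) c)"

definition transitive_digraph :: "('a, 'b) pre_digraph \<Rightarrow> bool" where
  "transitive_digraph D \<longleftrightarrow>
     (\<forall>x y z. distinct [x, y, z] \<longrightarrow> x \<rightarrow>\<^bsub>D\<^esub> y \<longrightarrow> y \<rightarrow>\<^bsub>D\<^esub> z \<longrightarrow> x \<rightarrow>\<^bsub>D\<^esub> z)"

definition shortcut :: "('a, 'b) pre_digraph \<Rightarrow> ('a, 'b) pre_digraph \<Rightarrow> bool" where
  "shortcut S D \<longleftrightarrow>
     induced_subgraph S D \<and> \<not> transitive_digraph S \<and>
     (\<exists>vs. 4 \<le> length vs \<and> set vs = verts S \<and> vpath vs S \<and> hd vs \<rightarrow>\<^bsub>S\<^esub> last vs)"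

definition semi_transitive_orientation :: "'a pair_pre_digraph \<Rightarrow> 'a pair_pre_digraph \<Rightarrow> bool" where
  "semi_transitive_orientation D G \<longleftrightarrow>
     acyclic_orientation D G \<and> (\<nexists>S. shortcut S (with_proj D))"

definition semi_transitively_orientable :: "'a pair_pre_digraph \<Rightarrow> bool" where
  "semi_transitively_orientable G \<longleftrightarrow> (\<exists>D. semi_transitive_orientation D G)"

definition add_edge :: "'a pair_pre_digraph \<Rightarrow> 'a \<Rightarrow> 'a \<Rightarrow> 'a pair_pre_digraph" where
  "add_edge G u v = G\<lparr>parcs := parcs G \<union> {(u, v), (v, u)}\<rparr>"

text \<open>
  The library's \<open>cycle\<close> is a directed closed walk, given as its list of arcs and without repeated
  vertices. On a symmetric digraph it also counts the closed walk \<open>u, v, u\<close>, which is not a cycle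
  of the undirected graph; this has even length. The odd cycles of a loop-free symmetric digraph
  are exactly the odd cycles of the undirected graph (each with a start vertex and a direction).
\<close>

definition no_odd_cycle_upto :: "'a pair_pre_digraph \<Rightarrow> nat \<Rightarrow> bool" where
  "no_odd_cycle_upto G m \<longleftrightarrow>
     (\<nexists>c. pre_digraph.cycle (with_proj G) c \<and> odd (length c) \<and> length c \<le> m)"

end

theory Submission
  imports Defs "HOL-Library.Nat_Bijection"
begin

text \<open>
  Call the ends of a walk with three edges in a graph \<open>R\<close> cube-adjacent. If \<open>R\<close> is not
  3-colourable and has no short odd closed walks, then the graph \<open>H\<close> of adjacent or cube-adjacent
  pairs is not semi-transitively orientable: as in the Gallai-Roy theorem, any orientation contains
  a directed walk \<open>a, b, c, d\<close> along edges of \<open>R\<close>; acyclicity forces \<open>a \<rightarrow> d\<close>, and \<open>a\<close>, \<open>c\<close> are not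
  adjacent in \<open>H\<close> because \<open>R\<close> has no closed walk of length 3 or 5. An odd closed walk of length
  \<open>n\<close> in \<open>H\<close> yields one of length at most \<open>3n\<close> in \<open>R\<close>.

  Such an \<open>R\<close> is a shift graph, obtained by iterating the line digraph construction on a large
  transitive tournament. Passing to the line digraph lowers the chromatic number at most
  logarithmically, and it lengthens the shortest odd closed walk by 2: in an acyclic digraph a
  closed walk must turn at a sink, and there its image under the map sending an arc to its head
  backtracks.

  Finally, an edge-maximal semi-transitively orientable spanning subgraph of \<open>H\<close> has the required
  property.
\<close>

section \<open>Colourings and odd closed walks\<close>

text \<open>The relation need not be symmetric, so the notion serves both an acyclic digraph and its
  symmetric closure.\<close>

definition colorable :: "'a rel \<Rightarrow> nat \<Rightarrow> bool" where
  "colorable E n \<longleftrightarrow> (\<exists>f. (\<forall>u. f u < n) \<and> (\<forall>(u, v) \<in> E. f u \<noteq> f v))"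

text \<open>Stated for closed walks rather than cycles: the image of a cycle under
  \<open>arc_head\<close>, or its expansion into walks of length three, may repeat vertices.\<close>

definition odd_free :: "'a rel \<Rightarrow> nat \<Rightarrow> bool" where
  "odd_free R m \<longleftrightarrow> (\<forall>n x. odd n \<longrightarrow> n \<le> m \<longrightarrow> (x, x) \<notin> R ^^ n)"

lemma odd_freeD: "odd_free R m \<Longrightarrow> odd n \<Longrightarrow> n \<le> m \<Longrightarrow> (x, x) \<notin> R ^^ n"
  by (simp add: odd_free_def)

lemma relpow_subset_trancl: "0 < n \<Longrightarrow> R ^^ n \<subseteq> R\<^sup>+"
  by (auto simp: trancl_power)

lemma relpow_mono: "R \<subseteq> S \<Longrightarrow> R ^^ n \<subseteq> S ^^ n" for R :: "'a rel"
  by (induction n) (simp_all add: relcomp_mono)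

text \<open>Otherwise the number of edges of a longest \<open>S\<close>-walk ending at a vertex,
  capped at 2, would be a proper 3-colouring, since it increases along every arc of
  \<open>S\<close>.\<close>

lemma directed_walk3_if_not_colorable:
  assumes "\<not> colorable E 3" and E: "\<And>u v. (u, v) \<in> E \<Longrightarrow> (u, v) \<in> S \<or> (v, u) \<in> S"
  obtains a b c d where "(a, b) \<in> S" "(b, c) \<in> S" "(c, d) \<in> S"
proof (rule ccontr)
  assume "\<not> thesis"
  then have no: "(a, b) \<in> S \<Longrightarrow> (b, c) \<in> S \<Longrightarrow> (c, d) \<in> S \<Longrightarrow> False" for a b c d
    using that by blast
  define f :: "'a \<Rightarrow> nat" where
    "f v = (if \<exists>a b. (a, b) \<in> S \<and> (b, v) \<in> S then 2 else if \<exists>a. (a, v) \<in> S then 1 else 0)" for v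
  have "f u < f v" if "(u, v) \<in> S" for u v
  proof -
    have "\<not> (\<exists>a b. (a, b) \<in> S \<and> (b, u) \<in> S)"
      using that no by blast
    then show ?thesis
      using that by (auto simp: f_def)
  qed
  then have "\<forall>(u, v) \<in> E. f u \<noteq> f v"
    using E by fastforce
  moreover have "f u < 3" for u
    by (auto simp: f_def)
  ultimately show False
    using assms(1) unfolding colorable_def by blast
qed

section \<open>Shift graphs\<close>

text \<open>Arcs are coded as natural numbers so that the construction can be iterated within one
  type.\<close>

definition line_rel :: "nat rel \<Rightarrow> nat rel" where
  "line_rel E = {(prod_encode (u, v), prod_encode (v, w)) | u v w. (u, v) \<in> E \<and> (v, w) \<in> E}"

abbreviation arc_head :: "nat \<Rightarrow> nat" where
  "arc_head x \<equiv> snd (prod_decode x)"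

lemma line_rel_heads: "(x, y) \<in> line_rel E \<Longrightarrow> (arc_head x, arc_head y) \<in> E"
  by (auto simp: line_rel_def)

text \<open>As arcs of \<open>E\<close>, both \<open>x\<close> and \<open>y\<close> end at the tail
  of \<open>z\<close>. This is what makes the image of a walk backtrack at a sink.\<close>

lemma line_rel_common_target:
  "(x, z) \<in> line_rel E \<Longrightarrow> (y, z) \<in> line_rel E \<Longrightarrow> arc_head x = arc_head y"
  by (auto simp: line_rel_def)

lemma line_rel_walk_heads:
  "(x, y) \<in> (line_rel E \<union> (line_rel E)\<inverse>) ^^ n \<Longrightarrow>
    (arc_head x, arc_head y) \<in> (E \<union> E\<inverse>) ^^ n"
proof (induction n arbitrary: y)
  case (Suc n)
  then obtain w where "(x, w) \<in> (line_rel E \<union> (line_rel E)\<inverse>) ^^ n"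
    and "(w, y) \<in> line_rel E \<union> (line_rel E)\<inverse>"
    by auto
  then have "(arc_head x, arc_head w) \<in> (E \<union> E\<inverse>) ^^ n"
    and "(arc_head w, arc_head y) \<in> E \<union> E\<inverse>"
    using Suc.IH by (blast, auto dest: line_rel_heads)
  then show ?case
    by auto
qed simp

lemma finite_line_rel:
  assumes "finite E"
  shows "finite (line_rel E)"
proof -
  have "line_rel E \<subseteq> (\<lambda>(e, e'). (prod_encode e, prod_encode e')) ` (E \<times> E)"
    by (auto simp: line_rel_def)
  then show ?thesis
    using assms finite_subset by blast
qed

lemma acyclic_line_rel:
  assumes "acyclic E"
  shows "acyclic (line_rel E)"
proof -
  have "(arc_head x, arc_head y) \<in> E\<^sup>+" if "(x, y) \<in> (line_rel E)\<^sup>+" for x y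
    using that by induction (auto dest: line_rel_heads intro: trancl_into_trancl)
  then show ?thesis
    using assms unfolding acyclic_def by blast
qed

text \<open>Colour a vertex by the set of colours of its outgoing arcs. If the ends of an arc
  \<open>(u, v)\<close> had equal sets, the colour of \<open>(u, v)\<close> would recur on some arc
  \<open>(v, w)\<close>, which is adjacent to \<open>(u, v)\<close> in the line digraph.\<close>

lemma colorable_line_rel:
  assumes "colorable (line_rel E) n"
  shows "colorable E (2 ^ n)"
proof -
  obtain f where f: "\<And>u. f u < n" and ne: "\<And>u v. (u, v) \<in> line_rel E \<Longrightarrow> f u \<noteq> f v"
    using assms unfolding colorable_def by blast
  define F where "F u = {f (prod_encode (u, v)) | v. (u, v) \<in> E}" for u
  have F: "F u \<in> Pow {..<n}" for u
    using f by (auto simp: F_def)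
  obtain g where g: "bij_betw g (Pow {..<n}) {0..<2 ^ n::nat}"
    using ex_bij_betw_finite_nat[of "Pow {..<n}"] by (auto simp: card_Pow)
  have "F u \<noteq> F v" if uv: "(u, v) \<in> E" for u v
  proof
    assume "F u = F v"
    moreover have "f (prod_encode (u, v)) \<in> F u"
      using uv by (auto simp: F_def)
    ultimately obtain w where "(v, w) \<in> E" "f (prod_encode (u, v)) = f (prod_encode (v, w))"
      by (auto simp: F_def)
    then show False
      using ne uv by (auto simp: line_rel_def)
  qed
  then have "\<forall>(u, v) \<in> E. g (F u) \<noteq> g (F v)"
    using inj_on_eq_iff[OF bij_betw_imp_inj_on[OF g] F F] by blast
  moreover have "g (F u) < 2 ^ n" for u
    using bij_betw_apply[OF g F] by auto
  ultimately show ?thesis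
    unfolding colorable_def by (intro exI[of _ "\<lambda>u. g (F u)"]) blast
qed

text \<open>In the first alternative the walk never turns at a sink.\<close>

lemma line_rel_walk_cases:
  assumes "(x, y) \<in> (line_rel E \<union> (line_rel E)\<inverse>) ^^ n"
  shows "(\<exists>i j. i + j = n \<and> (x, y) \<in> (line_rel E)\<inverse> ^^ i O line_rel E ^^ j) \<or>
    (2 \<le> n \<and> (arc_head x, arc_head y) \<in> (E \<union> E\<inverse>) ^^ (n - 2))"
  using assms
proof (induction n arbitrary: y)
  case 0
  then show ?case
    by auto
next
  case (Suc n)
  let ?S = "line_rel E"
  obtain w where xw: "(x, w) \<in> (?S \<union> ?S\<inverse>) ^^ n" and wy: "(w, y) \<in> ?S \<union> ?S\<inverse>"
    using Suc.prems by auto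
  have step: "(arc_head w, arc_head y) \<in> E \<union> E\<inverse>"
    using wy by (auto dest: line_rel_heads)
  from Suc.IH[OF xw] consider
      (bent) i j where "i + j = n" "(x, w) \<in> ?S\<inverse> ^^ i O ?S ^^ j"
    | (short) "2 \<le> n" "(arc_head x, arc_head w) \<in> (E \<union> E\<inverse>) ^^ (n - 2)"
    by blast
  then show ?case
  proof cases
    case short
    then have "(arc_head x, arc_head y) \<in> (E \<union> E\<inverse>) ^^ Suc (n - 2)"
      using step by auto
    then show ?thesis
      using short(1) by (simp only: Suc_diff_le) simp
  next
    case bent
    show ?thesis
    proof (cases "(w, y) \<in> ?S")
      case True
      then have "(x, y) \<in> ?S\<inverse> ^^ i O ?S ^^ Suc j"
        using bent(2) by auto
      then show ?thesis
        using bent(1) by (metis add_Suc_right)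
    next
      case False
      then have yw: "(y, w) \<in> ?S"
        using wy by auto
      show ?thesis
      proof (cases j)
        case 0
        then have "(x, y) \<in> ?S\<inverse> ^^ Suc i O ?S ^^ 0"
          using bent(2) yw by auto
        then show ?thesis
          using bent(1) 0 by (metis add_Suc add_0_right)
      next
        case (Suc j')
        obtain v z where xv: "(x, v) \<in> ?S\<inverse> ^^ i" and vz: "(v, z) \<in> ?S ^^ j'" and zw: "(z, w) \<in> ?S"
          using bent(2) Suc by auto
        \<comment> \<open>The walk turns at the sink \<open>w\<close>, between \<open>z\<close> and
          \<open>y\<close>. Their images coincide, so the two steps through \<open>w\<close> can be
          cut out of the image walk.\<close>
        have "arc_head z = arc_head y"
          using zw yw by (rule line_rel_common_target)
        have "(x, v) \<in> (?S \<union> ?S\<inverse>) ^^ i" "(v, z) \<in> (?S \<union> ?S\<inverse>) ^^ j'"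
          using xv vz relpow_mono[of "?S\<inverse>" "?S \<union> ?S\<inverse>"] relpow_mono[of ?S "?S \<union> ?S\<inverse>"]
          by blast+
        then have xz: "(x, z) \<in> (?S \<union> ?S\<inverse>) ^^ (i + j')"
          by (auto simp: relpow_add)
        have "(arc_head x, arc_head z) \<in> (E \<union> E\<inverse>) ^^ (i + j')"
          using xz by (rule line_rel_walk_heads)
        then show ?thesis
          using bent(1) Suc \<open>arc_head z = arc_head y\<close> by auto
      qed
    qed
  qed
qed

text \<open>A closed walk of length \<open>n\<close> yields one of length \<open>n - 2\<close> in
  \<open>E\<close>, also odd: the image is shortened at a sink, which is either an inner vertex of
  the walk or its base point \<open>x\<close>.\<close>

lemma odd_free_line_rel:
  assumes "acyclic E" and free: "odd_free (E \<union> E\<inverse>) m"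
  shows "odd_free (line_rel E \<union> (line_rel E)\<inverse>) (m + 2)"
  unfolding odd_free_def
proof (intro allI impI notI)
  let ?S = "line_rel E"
  fix n x
  assume n: "odd n" "n \<le> m + 2" and xx: "(x, x) \<in> (?S \<union> ?S\<inverse>) ^^ n"
  have acyc: "(z, z) \<notin> ?S ^^ l" if "0 < l" for z l
    using acyclic_line_rel[OF assms(1)] relpow_subset_trancl[OF that, of ?S]
    by (auto simp: acyclic_def)
  have acyc': "(z, z) \<notin> ?S\<inverse> ^^ l" if "0 < l" for z l
    using acyclic_line_rel[OF assms(1)] relpow_subset_trancl[OF that, of "?S\<inverse>"]
      acyclic_converse[of ?S]
    by (auto simp: acyclic_def)
  have no: "(z, z) \<notin> (E \<union> E\<inverse>) ^^ (n - 2)" if "2 \<le> n" for z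
    using free n that by (intro odd_freeD[OF free]) auto
  from line_rel_walk_cases[OF xx] no obtain i j
    where ij: "i + j = n" and turn: "(x, x) \<in> ?S\<inverse> ^^ i O ?S ^^ j"
    by blast
  \<comment> \<open>With \<open>i = 0\<close> or \<open>j = 0\<close> the walk would be a directed
    closed walk, traversed forwards or backwards.\<close>
  have "i \<noteq> 0"
    using turn ij acyc[of j x] odd_pos[OF n(1)] by (intro notI) simp
  have "j \<noteq> 0"
    using turn ij acyc'[of i x] odd_pos[OF n(1)] by (intro notI) simp
  obtain i' j' where i': "i = Suc i'" and j': "j = Suc j'"
    using \<open>i \<noteq> 0\<close> \<open>j \<noteq> 0\<close> not0_implies_Suc by blast
  obtain v where xv: "(x, v) \<in> ?S\<inverse> ^^ Suc i'" and vx: "(v, x) \<in> ?S ^^ Suc j'"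
    using turn i' j' by auto
  \<comment> \<open>The walk leaves \<open>x\<close> against an arc from \<open>z\<close> and
    returns along an arc from \<open>y\<close>, so \<open>x\<close> is a sink; without it,
    \<open>n - 2\<close> steps from \<open>z\<close> to \<open>y\<close> remain.\<close>
  obtain z where z: "(z, x) \<in> ?S" and zv: "(z, v) \<in> ?S\<inverse> ^^ i'"
    using relpow_Suc_D2[OF xv] by auto
  obtain y where y: "(y, x) \<in> ?S" and vy: "(v, y) \<in> ?S ^^ j'"
    using vx by auto
  have "(z, v) \<in> (?S \<union> ?S\<inverse>) ^^ i'" "(v, y) \<in> (?S \<union> ?S\<inverse>) ^^ j'"
    using zv vy relpow_mono[of "?S\<inverse>" "?S \<union> ?S\<inverse>"] relpow_mono[of ?S "?S \<union> ?S\<inverse>"] by blast+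
  then have zy: "(z, y) \<in> (?S \<union> ?S\<inverse>) ^^ (n - 2)"
    using ij i' j' by (auto simp: relpow_add)
  have "(arc_head z, arc_head z) \<in> (E \<union> E\<inverse>) ^^ (n - 2)"
    using line_rel_walk_heads[OF zy] line_rel_common_target[OF z y] by simp
  then show False
    using no ij i' j' by auto
qed

text \<open>Each passage to \<open>line_rel\<close> gains 2 in the length bound but loses a
  logarithm in the number of colours. The case \<open>c\<close> therefore draws on
  \<open>2 ^ c\<close>, and \<open>c\<close> has to vary in the induction.\<close>

lemma ex_not_colorable_odd_free:
  "\<exists>E :: nat rel. finite E \<and> acyclic E \<and> \<not> colorable E c \<and> odd_free (E \<union> E\<inverse>) (2 * r)"
proof (induction r arbitrary: c)
  case 0
  \<comment> \<open>The transitive tournament on \<open>c + 1\<close> vertices; the length bound 0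
    admits no odd length.\<close>
  define E :: "nat rel" where "E = {(i, j). i < j \<and> j \<le> c}"
  have "E \<subseteq> {..c} \<times> {..c}"
    by (auto simp: E_def)
  then have "finite E"
    using finite_subset by blast
  moreover have "acyclic E"
    by (rule acyclic_subset[OF wf_acyclic[OF wf_less]]) (auto simp: E_def)
  moreover have "\<not> colorable E c"
  proof
    assume "colorable E c"
    then obtain f where f: "\<And>u. f u < c" and ne: "\<And>u v. (u, v) \<in> E \<Longrightarrow> f u \<noteq> f v"
      unfolding colorable_def by blast
    have "inj_on f {..c}"
      by (rule linorder_inj_onI) (use ne in \<open>auto simp: E_def\<close>)
    moreover have "f ` {..c} \<subseteq> {..<c}"
      using f by auto
    ultimately have "card {..c} \<le> card {..<c}"
      by (rule card_inj_on_le) simp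
    then show False
      by simp
  qed
  moreover have "odd_free (E \<union> E\<inverse>) (2 * 0)"
    by (simp add: odd_free_def odd_pos)
  ultimately show ?case
    by blast
next
  case (Suc r)
  obtain E :: "nat rel" where "finite E" "acyclic E" "\<not> colorable E (2 ^ c)"
    "odd_free (E \<union> E\<inverse>) (2 * r)"
    using Suc by blast
  then have "finite (line_rel E) \<and> acyclic (line_rel E) \<and> \<not> colorable (line_rel E) c \<and>
    odd_free (line_rel E \<union> (line_rel E)\<inverse>) (2 * Suc r)"
    using finite_line_rel acyclic_line_rel colorable_line_rel odd_free_line_rel[of E "2 * r"]
    by auto
  then show ?case
    by blast
qed

section \<open>Adding the ends of walks of length three\<close>

definition cube_rel :: "'a rel \<Rightarrow> 'a rel" where
  "cube_rel R = R \<union> R ^^ 3"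

text \<open>Each step expands into one or three edges of \<open>R\<close>; both numbers are odd, so
  parity survives.\<close>

lemma relpow_cube_rel:
  assumes "(x, y) \<in> cube_rel R ^^ n"
  shows "\<exists>m \<le> 3 * n. even m = even n \<and> (x, y) \<in> R ^^ m"
  using assms
proof (induction n arbitrary: y)
  case 0
  then show ?case
    by auto
next
  case (Suc n)
  obtain w where xw: "(x, w) \<in> cube_rel R ^^ n" and wy: "(w, y) \<in> cube_rel R"
    using Suc.prems by auto
  obtain m where m: "m \<le> 3 * n" "even m = even n" "(x, w) \<in> R ^^ m"
    using Suc.IH[OF xw] by blast
  obtain l where l: "l = 1 \<or> l = 3" "(w, y) \<in> R ^^ l"
    using wy by (auto simp: cube_rel_def intro: that[of 1] that[of 3])
  have "(x, y) \<in> R ^^ (m + l)"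
    using m(3) l(2) by (auto simp: relpow_add)
  then show ?case
    using m(1,2) l(1) by (intro exI[of _ "m + l"]) auto
qed

lemma odd_free_cube_rel: "odd_free R (3 * m) \<Longrightarrow> odd_free (cube_rel R) m"
  unfolding odd_free_def by (meson relpow_cube_rel le_trans mult_le_mono2)

lemma sym_cube_rel: "sym R \<Longrightarrow> sym (cube_rel R)"
  unfolding cube_rel_def sym_def by (auto simp: numeral_3_eq_3) blast

lemma cube_rel_subset_Field: "cube_rel R \<subseteq> Field R \<times> Field R"
  unfolding cube_rel_def by (fastforce simp: Field_def numeral_3_eq_3)

section \<open>Cycles and shortcuts in orientations\<close>

lemma cycle_relpow:
  assumes "pre_digraph.cycle (with_proj G) c"
  obtains u where "(u, u) \<in> parcs G ^^ length c"
proof -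
  have "set p \<subseteq> parcs G \<Longrightarrow> pcas u p v \<Longrightarrow> (u, v) \<in> parcs G ^^ length p" for u p v
    by (induction u p v rule: pcas.induct) (auto simp del: relpow.simps(2) intro: relpow_Suc_I2)
  then show thesis
    using assms that
    unfolding pre_digraph.cycle_def pre_digraph.awalk_def cas_with_proj_eq with_proj_simps by blast
qed

lemma not_semi_transitively_orientable_cube_rel:
  fixes R :: "'a rel"
  assumes "\<not> colorable R 3" and "sym R" and free: "odd_free R 5"
  shows "\<not> semi_transitively_orientable \<lparr>pverts = Field R, parcs = cube_rel R\<rparr>"
proof
  let ?G = "\<lparr>pverts = Field R, parcs = cube_rel R\<rparr>"
  assume "semi_transitively_orientable ?G"
  then obtain D where D: "orientation D ?G"
    and acyc: "\<And>c. \<not> pre_digraph.cycle (with_proj D) c"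
    and nosc: "\<And>S. \<not> shortcut S (with_proj D)"
    unfolding semi_transitively_orientable_def semi_transitive_orientation_def
      acyclic_orientation_def by blast
  have verts: "pverts D = Field R" and sub: "parcs D \<subseteq> cube_rel R"
    and orient: "\<And>u v. (u, v) \<in> cube_rel R \<Longrightarrow> ((u, v) \<in> parcs D) \<noteq> ((v, u) \<in> parcs D)"
    using D unfolding orientation_def by auto
  have anti: "(v, u) \<notin> parcs D" if "(u, v) \<in> parcs D" for u v
    using orient sub that by blast
  have R_sub: "R \<subseteq> cube_rel R"
    by (auto simp: cube_rel_def)
  \<comment> \<open>The walk must follow edges of \<open>R\<close> itself, so that its ends are
    cube-adjacent.\<close>
  obtain a b c d where
    walk: "(a, b) \<in> parcs D \<inter> R" "(b, c) \<in> parcs D \<inter> R" "(c, d) \<in> parcs D \<inter> R"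
  proof (rule directed_walk3_if_not_colorable[OF assms(1)])
    show "(u, v) \<in> parcs D \<inter> R \<or> (v, u) \<in> parcs D \<inter> R" if "(u, v) \<in> R" for u v
      using that R_sub orient[of u v] symD[OF \<open>sym R\<close>] by blast
  qed (use that in blast)
  have in_Field: "{a, b, c, d} \<subseteq> Field R"
    using walk by (auto simp: Field_def)
  have ad: "(a, d) \<in> R ^^ 3"
    using walk by (auto simp: numeral_3_eq_3)
  have "a \<noteq> d"
    using odd_freeD[OF free, of 3] ad by auto
  have irrefl: "(u, u) \<notin> parcs D" for u
    using anti by blast
  \<comment> \<open>Any coincidence other than \<open>a = d\<close> would give a loop or a pair of
    opposite arcs in \<open>D\<close>.\<close>
  have dist: "distinct [a, b, c, d]"
    using walk anti irrefl \<open>a \<noteq> d\<close> by auto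
  \<comment> \<open>An edge \<open>ac\<close> is an \<open>R\<close>-walk of length 1 or 3; with the
    way back through \<open>b\<close> it closes to length 3 or 5.\<close>
  have ac: "(a, c) \<notin> cube_rel R"
  proof
    assume "(a, c) \<in> cube_rel R"
    then consider "(a, c) \<in> R ^^ 1" | "(a, c) \<in> R ^^ 3"
      by (auto simp: cube_rel_def)
    moreover have "(c, a) \<in> R ^^ 2"
      using walk symD[OF \<open>sym R\<close>] by (auto simp: numeral_2_eq_2)
    ultimately have "(a, a) \<in> R ^^ (1 + 2) \<or> (a, a) \<in> R ^^ (3 + 2)"
      unfolding relpow_add by blast
    moreover have "(a, a) \<notin> R ^^ (1 + 2)" "(a, a) \<notin> R ^^ (3 + 2)"
      by (rule odd_freeD[OF free]; simp)+
    ultimately show False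
      by blast
  qed
  have "(d, a) \<notin> parcs D"
  proof
    assume "(d, a) \<in> parcs D"
    then have "pre_digraph.cycle (with_proj D) [(a, b), (b, c), (c, d), (d, a)]"
      using walk dist in_Field verts
      by (auto simp: pre_digraph.cycle_def pre_digraph.awalk_def cas_with_proj_eq
          awalk_verts_with_proj_eq)
    then show False
      using acyc by blast
  qed
  then have adD: "(a, d) \<in> parcs D"
    using ad orient[of a d] by (auto simp: cube_rel_def)
  interpret pair_wf_digraph D
    using sub cube_rel_subset_Field[of R] verts by unfold_locales auto
  let ?S = "with_proj D \<restriction> {a, b, c, d}"
  have arcs_S: "arcs_ends ?S = {(u, v) \<in> parcs D. u \<in> {a, b, c, d} \<and> v \<in> {a, b, c, d}}"
    by (auto simp: arcs_ends_conv induce_subgraph_def)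
  have "induced_subgraph ?S (with_proj D)"
    using in_Field verts by (intro induced_induce) auto
  moreover have "\<not> transitive_digraph ?S"
    using walk dist ac sub unfolding transitive_digraph_def arcs_S by fastforce
  moreover have "4 \<le> length [a, b, c, d] \<and> set [a, b, c, d] = verts ?S \<and> vpath [a, b, c, d] ?S \<and>
      hd [a, b, c, d] \<rightarrow>\<^bsub>?S\<^esub> last [a, b, c, d]"
    using walk dist adD unfolding vpath_def vwalk_def arcs_S by auto
  ultimately have "shortcut ?S (with_proj D)"
    unfolding shortcut_def by blast
  then show False
    using nosc by blast
qed

section \<open>Edge-maximal semi-transitively orientable subgraphs\<close>

lemma semi_transitively_orientable_no_arcs:
  assumes "parcs G = {}"
  shows "semi_transitively_orientable G"
proof -
  have "\<not> pre_digraph.cycle (with_proj G) c" for c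
    using assms by (auto simp: pre_digraph.cycle_def pre_digraph.awalk_def)
  moreover have "\<not> shortcut S (with_proj G)" for S
    using assms unfolding shortcut_def induced_subgraph_def by (auto simp: arcs_ends_def)
  ultimately have "semi_transitive_orientation G G"
    using assms
    unfolding semi_transitive_orientation_def acyclic_orientation_def orientation_def by auto
  then show ?thesis
    unfolding semi_transitively_orientable_def by blast
qed

text \<open>The arcless graph belongs to the family of orientable symmetric subrelations and
  \<open>A\<close> does not, so a maximal member \<open>B\<close> misses an edge \<open>uv\<close>
  of \<open>A\<close>. Adding \<open>uv\<close> stays inside \<open>A\<close> and hence, by
  maximality, leaves the family.\<close>

lemma ex_maximal_semi_transitively_orientable:
  assumes "finite A" "sym A" "\<not> semi_transitively_orientable \<lparr>pverts = V, parcs = A\<rparr>"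
  obtains B u v where "B \<subseteq> A" "sym B" "semi_transitively_orientable \<lparr>pverts = V, parcs = B\<rparr>"
    "(u, v) \<in> A" "(u, v) \<notin> B"
    "\<not> semi_transitively_orientable (add_edge \<lparr>pverts = V, parcs = B\<rparr> u v)"
proof -
  let ?F = "{B. B \<subseteq> A \<and> sym B \<and> semi_transitively_orientable \<lparr>pverts = V, parcs = B\<rparr>}"
  have "finite ?F"
    using assms(1) by simp
  moreover have "{} \<in> ?F"
    by (auto intro: semi_transitively_orientable_no_arcs simp: sym_def)
  ultimately obtain B where B: "B \<in> ?F" and max: "\<And>C. C \<in> ?F \<Longrightarrow> B \<subseteq> C \<Longrightarrow> C = B"
    using finite_has_maximal[of ?F] by (metis (no_types, lifting) empty_iff)
  have "B \<noteq> A"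
    using B assms(3) by auto
  then obtain u v where uv: "(u, v) \<in> A" "(u, v) \<notin> B"
    using B by auto
  let ?C = "B \<union> {(u, v), (v, u)}"
  have "?C \<subseteq> A" "sym ?C"
    using B uv symD[OF assms(2)] by (auto simp: sym_def)
  then have "\<not> semi_transitively_orientable \<lparr>pverts = V, parcs = ?C\<rparr>"
    using max[of ?C] uv by blast
  then show thesis
    using that[of B u v] B uv by (simp add: add_edge_def)
qed

theorem theorem1p13:
  fixes k :: nat
  assumes "k > 0"
  shows "\<exists>G :: nat pair_pre_digraph.
    pair_graph G \<and> semi_transitively_orientable G \<and> no_odd_cycle_upto G (2 * k + 1) \<and>
    (\<exists>u \<in> pverts G. \<exists>v \<in> pverts G.
       u \<noteq> v \<and> (u, v) \<notin> parcs G \<and> \<not> semi_transitively_orientable (add_edge G u v))"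
proof -
  \<comment> \<open>The bound \<open>6 * k + 4\<close> covers both lengths needed below:
    \<open>3 * (2 * k + 1)\<close>, which survives as \<open>2 * k + 1\<close> in the cube, and 5,
    since \<open>k\<close> is positive.\<close>
  obtain E :: "nat rel" where E: "finite E" "\<not> colorable E 3"
    and free: "odd_free (E \<union> E\<inverse>) (2 * (3 * k + 2))"
    using ex_not_colorable_odd_free by blast
  define R where "R = E \<union> E\<inverse>"
  have sym: "sym R"
    unfolding R_def by (rule sym_Un_converse)
  have fin_V: "finite (Field R)"
    using E(1) unfolding R_def by (intro finite_Field) simp
  have fin: "finite (cube_rel R)"
    using cube_rel_subset_Field fin_V fin_V by (rule finite_subset[OF _ finite_cartesian_product])
  have "\<not> colorable R 3"
    using E(2) unfolding R_def colorable_def by blast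
  moreover have "odd_free R 5"
    using free \<open>k > 0\<close> unfolding odd_free_def R_def by auto
  ultimately have "\<not> semi_transitively_orientable \<lparr>pverts = Field R, parcs = cube_rel R\<rparr>"
    using sym by (intro not_semi_transitively_orientable_cube_rel)
  then obtain B u v where B: "B \<subseteq> cube_rel R" "sym B"
    and orientable: "semi_transitively_orientable \<lparr>pverts = Field R, parcs = B\<rparr>"
    and uv: "(u, v) \<in> cube_rel R" "(u, v) \<notin> B"
    and not_orientable: "\<not> semi_transitively_orientable (add_edge \<lparr>pverts = Field R, parcs = B\<rparr> u v)"
    using ex_maximal_semi_transitively_orientable[OF fin sym_cube_rel[OF sym]] by metis
  let ?G = "\<lparr>pverts = Field R, parcs = B\<rparr>"
  have "odd_free R (3 * (2 * k + 1))"
    using free unfolding odd_free_def R_def by auto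
  then have odd_free: "odd_free (cube_rel R) (2 * k + 1)"
    by (rule odd_free_cube_rel)
  \<comment> \<open>A loop is a closed walk of length 1.\<close>
  have irrefl: "(x, x) \<notin> cube_rel R" for x
    using odd_freeD[OF odd_free, of 1 x] by simp
  have "pair_graph ?G"
  proof
    show "finite (parcs ?G)"
      using B(1) fin finite_subset by auto
    show "fst e \<noteq> snd e" if "e \<in> parcs ?G" for e
      using that B(1) irrefl by (cases e) auto
  qed (use B fin_V cube_rel_subset_Field[of R] in \<open>auto simp: symmetric_def\<close>)
  moreover have "no_odd_cycle_upto ?G (2 * k + 1)"
    unfolding no_odd_cycle_upto_def
  proof (intro notI, elim exE conjE)
    fix c
    assume "pre_digraph.cycle (with_proj ?G) c" and c: "odd (length c)" "length c \<le> 2 * k + 1"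
    then obtain x where "(x, x) \<in> B ^^ length c"
      by (auto elim: cycle_relpow)
    then have "(x, x) \<in> cube_rel R ^^ length c"
      using relpow_mono[OF B(1)] by blast
    then show False
      using odd_freeD[OF odd_free c] by blast
  qed
  moreover have "u \<in> Field R" "v \<in> Field R" "u \<noteq> v"
    using uv(1) cube_rel_subset_Field[of R] irrefl by auto
  ultimately show ?thesis
    using orientable uv(2) not_orientable by (intro exI[of _ ?G]) auto
qed

end
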